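(* Let $n$ and $d\neq 1$ be positive integers. If $n\equiv 1 \pmod{2d}$, then, modulo $\Phi_{n}(q)^2$, \[ \sum_{k=0}^{(n-1)/d}[3dk-1]\frac{(q^{-1};q^{2d})_k(q^{d-3};q^d)_k(q;q^d)_k^2}{(q^d;q^d)_k(q^{d+2};q^{2d})_k(q^{2d-2};q^{2d})_k^2}q^{d(k^2+k)/2+1} \equiv -\frac{(q^{d};q^{2d})_{(n-1)/(2d)}(q^{2d-1};q^{2d})_{(n-1)/(2d)}}{(q^{3};q^{2d})_{(n-1)/(2d)}(q^{d+2};q^{2d})_{(n-1)/(2d)}}\,q^{(3-d)(n-1)/(2d)}, \] and if $n\equiv d+1 \pmod{2d}$, then the same sum is $\equiv 0 \pmod{\Phi_{n}(q)^2}$.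
   Context: For an indeterminate $q$, $(x;q)_k=(1-x)(1-xq)\cdots(1-xq^{k-1})$ (with $(x;q)_0=1$). $[m]=(1-q^m)/(1-q)$ is the $q$-integer for any integer $m$ (so $[3dk-1]=(1-q^{3dk-1})/(1-q)$), and $\Phi_n(q)$ is the $n$-th cyclotomic polynomial. A congruence between rational functions in $q$ modulo a polynomial $P(q)$ means that the difference is $P(q)$ times a rational function whose denominator is coprime to $P(q)$.
   Formalization: The second congruence (n ≡ d+1 mod 2d) is stated only for d ≠ 3: for d = 3 the factor (q^{d-3};q^d)_k vanishes for k ≥ 1, so the sum equals −1 and is never ≡ 0 modulo Φ_n(q)^2 (e.g. n = 4); the first congruence includes d = 3. *)

theory Defs
  imports "HOL-Analysis.Analysis" "HOL-Computational_Algebra.Computational_Algebra"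
    "HOL-Number_Theory.Cong"
begin

text \<open>
  Rational functions in the indeterminate \<open>q\<close> are taken with complex coefficients, so that the
  cyclotomic polynomial can be given by its product over the primitive roots of unity.
\<close>

type_synonym ratfun = "complex poly fract"

definition qvar :: ratfun where
  "qvar = Fract [:0, 1:] 1"

definition qpoch :: "'a::field \<Rightarrow> 'a \<Rightarrow> nat \<Rightarrow> 'a" where
  "qpoch x q k = (\<Prod>j<k. 1 - x * q ^ j)"

definition qint :: "'a::field \<Rightarrow> int \<Rightarrow> 'a" where
  "qint q m = (1 - q powi m) / (1 - q)"

definition cyclotomic :: "nat \<Rightarrow> complex poly" where
  "cyclotomic n = (\<Prod>k | k \<in> {1..n} \<and> coprime k n. [:- cis (2 * pi * real k / real n), 1:])"

text \<open>The condition \<open>b \<noteq> 0\<close> is explicit because \<open>Fract a 0 = 0\<close>.\<close>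

definition rf_cong :: "ratfun \<Rightarrow> ratfun \<Rightarrow> complex poly \<Rightarrow> bool" where
  "rf_cong f g P \<longleftrightarrow>
     (\<exists>a b. b \<noteq> 0 \<and> coprime b P \<and> f - g = Fract P 1 * Fract a b)"

text \<open>
  The upper limit \<open>(n - 1) div d\<close> is exact whenever \<open>d\<close> divides \<open>n - 1\<close>, the exponent
  \<open>d * (k\<^sup>2 + k) div 2\<close> always, and \<open>(n - 1) div (2 * d)\<close> if \<open>n\<close> is congruent to 1 modulo \<open>2 * d\<close>.
\<close>

definition qsum :: "nat \<Rightarrow> nat \<Rightarrow> ratfun" where
  "qsum n d = (let q = qvar in
     \<Sum>k = 0..(n - 1) div d.
       qint q (3 * int d * int k - 1)
       * (qpoch (q powi (-1)) (q ^ (2 * d)) k * qpoch (q powi (int d - 3)) (q ^ d) k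
          * (qpoch q (q ^ d) k)\<^sup>2)
       / (qpoch (q ^ d) (q ^ d) k * qpoch (q ^ (d + 2)) (q ^ (2 * d)) k
          * (qpoch (q powi (2 * int d - 2)) (q ^ (2 * d)) k)\<^sup>2)
       * q ^ (d * (k\<^sup>2 + k) div 2 + 1))"

definition qrhs :: "nat \<Rightarrow> nat \<Rightarrow> ratfun" where
  "qrhs n d = (let q = qvar; m = (n - 1) div (2 * d) in
     - ((qpoch (q ^ d) (q ^ (2 * d)) m * qpoch (q powi (2 * int d - 1)) (q ^ (2 * d)) m)
        / (qpoch (q ^ 3) (q ^ (2 * d)) m * qpoch (q ^ (d + 2)) (q ^ (2 * d)) m))
     * q powi ((3 - int d) * int m))"

text \<open>
  For \<open>d = 3\<close> the factor \<open>(q\<^sup>0; q\<^sup>3)\<^sub>k\<close> vanishes for every \<open>k \<ge> 1\<close>, so the sum collapses to its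
  first term, which is \<open>-1\<close>.  Hence the vanishing congruence fails for \<open>d = 3\<close> and
  every \<open>n > 0\<close>.
\<close>

lemma qvar_nz: "qvar \<noteq> 0"
  by (simp add: qvar_def Zero_fract_def eq_fract)

lemma qvar_ne_1: "1 - qvar \<noteq> 0"
  by (auto simp: qvar_def One_fract_def Zero_fract_def eq_fract one_pCons)

lemma qsum_3: "qsum n 3 = -1"
proof -
  have z: "qpoch (qvar powi (int 3 - 3)) (qvar ^ 3) k = 0" if "k \<noteq> 0" for k
    using that by (auto simp: qpoch_def prod_zero_iff intro!: bexI[of _ 0])
  have "qsum n 3 = (\<Sum>k = 0..(n - 1) div 3. if k = 0 then -1 else 0)"
    unfolding qsum_def Let_def
  proof (rule sum.cong[OF refl], goal_cases)
    case (1 k)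
    show ?case
    proof (cases "k = 0")
      case True
      have "qint qvar (-1) * qvar = -1"
        using qvar_nz qvar_ne_1 by (simp add: qint_def field_simps power_int_minus)
      then show ?thesis using True by (simp add: qpoch_def)
    next
      case False
      show ?thesis unfolding z[OF False] using False by simp
    qed
  qed
  then show ?thesis by simp
qed

lemma degree_cyclotomic: "degree (cyclotomic n) = card {k. k \<in> {1..n} \<and> coprime k n}"
  unfolding cyclotomic_def by (subst degree_prod_eq_sum_degree) auto

lemma not_rf_cong_qsum_3:
  assumes "n > 0"
  shows "\<not> rf_cong (qsum n 3) 0 ((cyclotomic n)\<^sup>2)"
proof
  assume "rf_cong (qsum n 3) 0 ((cyclotomic n)\<^sup>2)"
  then obtain a b where b: "b \<noteq> 0" "coprime b ((cyclotomic n)\<^sup>2)"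
    and eq: "-1 = Fract ((cyclotomic n)\<^sup>2) 1 * Fract a b"
    by (auto simp: rf_cong_def qsum_3)
  from eq b(1) have "- b = (cyclotomic n)\<^sup>2 * a"
    by (simp add: One_fract_def eq_fract)
  then have "(cyclotomic n)\<^sup>2 dvd b"
    by (metis dvd_minus_iff dvd_triv_left)
  with b(2) have u: "is_unit ((cyclotomic n)\<^sup>2)"
    by (metis coprime_def dvd_refl)
  then have "is_unit (cyclotomic n)"
    by (simp add: is_unit_power_iff)
  then have "degree (cyclotomic n) = 0"
    by (metis is_unit_iff_degree not_is_unit_0)
  moreover have "1 \<in> {k. k \<in> {1..n} \<and> coprime k n}"
    using assms by auto
  moreover have "finite {k. k \<in> {1..n} \<and> coprime k n}"
    by simp
  ultimately show False
    unfolding degree_cyclotomic using card_gt_0_iff by fastforce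
qed

end

theory Submission
  imports Defs "HOL-Library.Real_Mod" "HOL-Computational_Algebra.Field_as_Ring"
begin

text \<open>
  Write \<open>n = 1 + d N\<close>, \<open>p = q\<^sup>d\<close>, \<open>A = q\<^sup>-\<^sup>1\<close> and \<open>e = q\<^sup>2\<close>.  From
  \[(1 - u q^{n})(1 - u q^{-n}) = (1 - u)^2 - u q^{-n} (1 - q^n)^2\]
  it follows that, modulo \<open>\<Phi>\<^sub>n(q)\<^sup>2\<close>, every squared factor \<open>(1 - u)\<^sup>2\<close> of the sum may be replaced by
  the product on the left; the denominators stay coprime to \<open>\<Phi>\<^sub>n(q)\<close> if \<open>d \<noteq> 3\<close>.  The deformed sum
  is the case \<open>b = p\<^sup>-\<^sup>N\<close>, \<open>c = e / b\<close> of
  \[\sum_k \frac{1 - A p^{3k}}{1 - A} \frac{(A; p^2)_k (b, c, A p / bc; p)_k}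
      {(p; p)_k (A p^2 / b, A p^2 / c, b c p; p^2)_k} p^{k(k+1)/2},\]
  a limit of the quadratic summation of Gasper and Rahman.  With \<open>b c = e\<close> fixed, creative
  telescoping gives a first-order recurrence in the step from \<open>N\<close> to \<open>N + 2\<close>, so the sum has a
  closed form for even \<open>N\<close>, which is exactly the right-hand side, and vanishes for odd \<open>N\<close>.
  For \<open>d = 3\<close> both sides of the first congruence are \<open>-1\<close>.
\<close>

section \<open>A terminating quadratic summation\<close>

lemma qpoch_0 [simp]: "qpoch x q 0 = 1"
  by (simp add: qpoch_def)

lemma qpoch_Suc: "qpoch x q (Suc k) = qpoch x q k * (1 - x * q ^ k)"
  by (simp add: qpoch_def)

text \<open>Both sides are the product of the first \<open>k + 1\<close> factors, with the first or
  the last one split off.\<close>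

lemma qpoch_shift: "(1 - x) * qpoch (x * q) q k = qpoch x q k * (1 - x * q ^ k)"
proof (induction k)
  case (Suc k)
  have "(1 - x) * qpoch (x * q) q (Suc k) = (1 - x) * qpoch (x * q) q k * (1 - x * q ^ Suc k)"
    by (simp add: qpoch_Suc)
  then show ?case
    by (simp add: Suc.IH qpoch_Suc)
qed simp

text \<open>What remains of the telescoping identity once \<open>p ^ k\<close> is replaced by a free
  variable \<open>K\<close> and all denominators are cleared.\<close>

lemma wz_poly:
  fixes A e p M K :: "'a::comm_ring_1"
  shows "- (M*p^2-1) * p * (1-A*K^3)*(1-e*M*K)*(1-e*M*p*K)*(M*e-A*K^2)
     + (1-e*M)*e*(1-A*K^3)*(M*p^2-K)*(M*p-K)*(1-A*p^2*M*K^2)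
   = -(1-e*p^2*M^2) * ((1-A*K^2)*(M*p^2-K)*(1-e*M*K)*(e-A*p*K)*K
      - (1-A*p^2*M*K^2)*(M*e-A*K^2)*(1-K)*(p-e*K^2))"
  by (simp add: algebra_simps power2_eq_square power3_eq_cube)

text \<open>The deformed summand with \<open>b = 1 / M\<close> and \<open>c = e * M\<close>, so that
  \<open>A * p / (b * c)\<close> is \<open>A * p / e\<close>; the constant
  \<open>1 / (1 - A)\<close> is left out. For \<open>M = p ^ N\<close> the sum terminates at
  \<open>k = N\<close>.\<close>

definition qterm :: "'a::field \<Rightarrow> 'a \<Rightarrow> 'a \<Rightarrow> 'a \<Rightarrow> nat \<Rightarrow> 'a" where
  "qterm A e p M k = (1 - A * p ^ (3 * k))
     * (qpoch A (p\<^sup>2) k * qpoch (1 / M) p k * qpoch (e * M) p k * qpoch (A * p / e) p k)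
     / (qpoch p p k * qpoch (A * p\<^sup>2 * M) (p\<^sup>2) k * qpoch (A * p\<^sup>2 / (e * M)) (p\<^sup>2) k
        * qpoch (e * p) (p\<^sup>2) k)
     * p ^ (k * (k + 1) div 2)"

text \<open>
  The common part of the terms with parameters \<open>M\<close> and \<open>M * p\<^sup>2\<close>; both are rational multiples of it.
\<close>

definition qbase :: "'a::field \<Rightarrow> 'a \<Rightarrow> 'a \<Rightarrow> 'a \<Rightarrow> nat \<Rightarrow> 'a" where
  "qbase A e p M k =
     qpoch A (p\<^sup>2) k * qpoch (1 / (M * p\<^sup>2)) p k * qpoch (e * M) p k * qpoch (A * p / e) p k
     / (qpoch p p k * qpoch (A * p\<^sup>2 * M) (p\<^sup>2) k * qpoch (A * p\<^sup>2 / (e * M)) (p\<^sup>2) k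
        * qpoch (e * p) (p\<^sup>2) k)
     * p ^ (k * (k + 1) div 2)"

lemma qpoch_shift_eq:
  fixes x q :: "'a::field"
  assumes "x \<noteq> 1"
  shows "qpoch (x * q) q k = qpoch x q k * (1 - x * q ^ k) / (1 - x)"
  using qpoch_shift[of x q k] assms by (simp add: field_simps)

lemma qpoch_shift2_eq:
  fixes x q :: "'a::field"
  assumes "x \<noteq> 1" "x * q \<noteq> 1"
  shows "qpoch (x * q\<^sup>2) q k = qpoch x q k * ((1 - x * q ^ k) * (1 - x * q * q ^ k)) / ((1 - x) * (1 - x * q))"
  using qpoch_shift_eq[of x q k] qpoch_shift_eq[of "x * q" q k] assms
  by (simp add: power2_eq_square mult.assoc)

lemma qbase_Suc:
  "qbase A e p M (Suc k) = qbase A e p M k *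
     ((1 - A * (p ^ k)\<^sup>2) * (1 - p ^ k / (M * p\<^sup>2)) * (1 - e * M * p ^ k) * (1 - A * p * p ^ k / e)
       * (p * p ^ k))
     / ((1 - p * p ^ k) * (1 - A * p\<^sup>2 * M * (p ^ k)\<^sup>2) * (1 - A * p\<^sup>2 * (p ^ k)\<^sup>2 / (e * M))
        * (1 - e * p * (p ^ k)\<^sup>2))"
proof -
  have "Suc k * (Suc k + 1) div 2 = k * (k + 1) div 2 + Suc k"
    by simp
  moreover have "(p\<^sup>2) ^ k = (p ^ k)\<^sup>2"
    by (simp add: power_mult[symmetric] mult.commute)
  ultimately show ?thesis
    by (simp add: qbase_def qpoch_Suc power_add mult_ac)
qed

text \<open>Apart from the factor \<open>1 - A * p ^ (3 * k)\<close>, only the symbol at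
  \<open>1 / M\<close> differs from the common part, whose symbol starts two steps earlier.\<close>

lemma qterm_eq_qbase:
  fixes A e p M :: "'a::field"
  assumes "p \<noteq> 0" "M * p\<^sup>2 \<noteq> 1" "M * p \<noteq> 1" "M \<noteq> 0"
  shows "qterm A e p M k = qbase A e p M k *
    ((1 - A * (p ^ k)^3) * ((1 - p ^ k / (M * p\<^sup>2)) * (1 - p ^ k / (M * p)))
     / ((1 - 1 / (M * p\<^sup>2)) * (1 - 1 / (M * p))))"
proof -
  have "qpoch (1 / M) p k = qpoch (1 / (M * p\<^sup>2)) p k *
     ((1 - p ^ k / (M * p\<^sup>2)) * (1 - p ^ k / (M * p))) / ((1 - 1 / (M * p\<^sup>2)) * (1 - 1 / (M * p)))"
    using qpoch_shift2_eq[of "1 / (M * p\<^sup>2)" p k] assms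
    by (simp add: field_simps power2_eq_square)
  moreover have "p ^ (3 * k) = (p ^ k) ^ 3"
    by (simp add: power_mult[symmetric] mult.commute)
  ultimately show ?thesis
    by (simp add: qterm_def qbase_def mult_ac)
qed

text \<open>Passing to \<open>M * p\<^sup>2\<close> moves the symbol at \<open>e * M\<close> by two
  steps of \<open>p\<close>, and the two denominator symbols containing \<open>M\<close> by one step
  of \<open>p\<^sup>2\<close> in opposite directions.\<close>

lemma qterm_shift_eq_qbase:
  fixes A e p M :: "'a::field"
  assumes "p \<noteq> 0" "M \<noteq> 0" "e \<noteq> 0" "e * M \<noteq> 1" "e * M * p \<noteq> 1"
    and "A \<noteq> e * M" "A * p\<^sup>2 * M \<noteq> 1" "A * p\<^sup>2 * M * (p ^ k)\<^sup>2 \<noteq> 1"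
    and nz: "\<And>i. A * p\<^sup>2 / (e * M) * p ^ i \<noteq> 1" 
  shows "qterm A e p (M * p\<^sup>2) k = qbase A e p M k *
    ((1 - A * (p ^ k)^3) * ((1 - e * M * p ^ k) * (1 - e * M * p * p ^ k))
      * (1 - A * p\<^sup>2 * M) * (1 - A * (p ^ k)\<^sup>2 / (e * M))
     / ((1 - e * M) * (1 - e * M * p) * (1 - A * p\<^sup>2 * M * (p ^ k)\<^sup>2) * (1 - A / (e * M))))"
proof -
  have pk: "(p\<^sup>2) ^ k = (p ^ k)\<^sup>2"
    by (simp add: power_mult[symmetric] mult.commute)
  have 1: "qpoch (e * (M * p\<^sup>2)) p k = qpoch (e * M) p k *
     ((1 - e * M * p ^ k) * (1 - e * M * p * p ^ k)) / ((1 - e * M) * (1 - e * M * p))"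
    using qpoch_shift2_eq[of "e * M" p k] assms by (simp add: mult.assoc)
  have 2: "qpoch (A * p\<^sup>2 * (M * p\<^sup>2)) (p\<^sup>2) k =
     qpoch (A * p\<^sup>2 * M) (p\<^sup>2) k * (1 - A * p\<^sup>2 * M * (p ^ k)\<^sup>2) / (1 - A * p\<^sup>2 * M)"
    using qpoch_shift_eq[of "A * p\<^sup>2 * M" "p\<^sup>2" k] assms pk by (simp add: mult.assoc)
  have "(1 - A / (e * M)) * qpoch (A * p\<^sup>2 / (e * M)) (p\<^sup>2) k =
     qpoch (A / (e * M)) (p\<^sup>2) k * (1 - A * (p ^ k)\<^sup>2 / (e * M))"
    using qpoch_shift[of "A / (e * M)" "p\<^sup>2" k] pk by (simp add: mult.assoc)
  moreover have "1 - A / (e * M) \<noteq> 0"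
    using assms by simp
  moreover have "qpoch (A * p\<^sup>2 / (e * M)) (p\<^sup>2) k \<noteq> 0"
    unfolding qpoch_def using nz by (auto simp: power_mult[symmetric])
  \<comment> \<open>The left side of the shift rule is nonzero, hence so is the symbol at
    \<open>A / (e * M)\<close>, and the rule can be solved for its inverse.\<close>
  ultimately have 3: "inverse (qpoch (A / (e * M)) (p\<^sup>2) k) =
      (1 - A * (p ^ k)\<^sup>2 / (e * M)) / ((1 - A / (e * M)) * qpoch (A * p\<^sup>2 / (e * M)) (p\<^sup>2) k)"
    by (metis (no_types, lifting) divide_eq_eq inverse_eq_divide mult.commute mult_eq_0_iff nonzero_mult_div_cancel_left
       nonzero_mult_divide_mult_cancel_left2 divide_self_if)
  have 4: "A * p\<^sup>2 / (e * (M * p\<^sup>2)) = A / (e * M)"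
    using assms by simp
  have 5: "p ^ (3 * k) = (p ^ k) ^ 3"
    by (simp add: power_mult[symmetric] mult.commute)
  show ?thesis
    unfolding qterm_def qbase_def 1 2 4 5 using 3
    by (simp add: divide_inverse)
qed

text \<open>The telescoping identity divided by \<open>qbase A e p M k\<close>, with
  \<open>K\<close> for \<open>p ^ k\<close>. On the right, the first product comes from the
  certificate at \<open>k + 1\<close>, the second from the one at \<open>k\<close>.\<close>

lemma wz_step:
  fixes A e p M K :: "'a::field"
  assumes nz: "p \<noteq> 0" "M \<noteq> 0" "e \<noteq> 0" "e * M \<noteq> 1" "e * M * p \<noteq> 1" "A \<noteq> e * M"
    "M * p\<^sup>2 \<noteq> 1" "M * p \<noteq> 1" "A * p\<^sup>2 * M * K\<^sup>2 \<noteq> 1"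
  shows "(1 - A * K^3) * ((1 - e * M * K) * (1 - e * M * p * K))
      * (1 - A * p\<^sup>2 * M) * (1 - A * K\<^sup>2 / (e * M))
     / ((1 - e * M) * (1 - e * M * p) * (1 - A * p\<^sup>2 * M * K\<^sup>2) * (1 - A / (e * M)))
   - ((1 - M * p) * (1 - A * p\<^sup>2 * M) * e / ((A - e * M) * (1 - e * M * p) * p))
     * ((1 - A * K^3) * ((1 - K / (M * p\<^sup>2)) * (1 - K / (M * p)))
     / ((1 - 1 / (M * p\<^sup>2)) * (1 - 1 / (M * p))))
   = ((1 - A * p\<^sup>2 * M) * e * M * (1 - e * p\<^sup>2 * M\<^sup>2)
        / ((1 - e * M) * (1 - e * M * p) * (A - e * M) * (1 - M * p\<^sup>2)))
     * ((1 - A * K\<^sup>2) * (1 - K / (M * p\<^sup>2)) * (1 - e * M * K) * (1 - A * p * K / e) * (p * K)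
         / (1 - A * p\<^sup>2 * M * K\<^sup>2)
        - (1 - A * K\<^sup>2 / (e * M)) * (1 - K) * (1 - e * K\<^sup>2 / p))"
    (is "?T2 - ?r * ?T1 = ?c * (?G1 - ?G0)")
proof -
  \<comment> \<open>Every factor gets a name, so that \<open>divide_simps\<close> only moves
    denominators and expands no product.\<close>
  define D where "D = 1 - A * p\<^sup>2 * M * K\<^sup>2"
  define w where "w = M * p\<^sup>2 - 1"
  define v where "v = M * p - 1"
  define a where "a = 1 - e * M"
  define b where "b = 1 - e * M * p"
  define f where "f = A - e * M"
  define s where "s = 1 - A * p\<^sup>2 * M"
  \<comment> \<open>The common factor of all four summands; the cofactors are the polynomials of
    \<open>wz_poly\<close>.\<close>
  define \<kappa> where "\<kappa> = s / (a * b * f * w * D * p)"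
  have nz': "D \<noteq> 0" "w \<noteq> 0" "v \<noteq> 0" "a \<noteq> 0" "b \<noteq> 0" "f \<noteq> 0"
    using nz by (auto simp: D_def w_def v_def a_def b_def f_def)
  have w: "1 - 1 / (M * p\<^sup>2) = w / (M * p\<^sup>2)" "1 - M * p\<^sup>2 = - w"
    using nz by (simp_all add: w_def field_simps)
  have v: "1 - 1 / (M * p) = v / (M * p)" "1 - M * p = - v"
    using nz by (simp_all add: v_def field_simps)
  have f: "1 - A / (e * M) = - f / (e * M)"
    using nz by (simp add: f_def field_simps)
  define x where "x = M * p\<^sup>2 - K"
  have x: "1 - K / (M * p\<^sup>2) = x / (M * p\<^sup>2)"
    using nz by (simp add: x_def field_simps)
  define y where "y = M * p - K"
  have y: "1 - K / (M * p) = y / (M * p)"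
    using nz by (simp add: y_def field_simps)
  define z where "z = M * e - A * K\<^sup>2"
  have z: "1 - A * K\<^sup>2 / (e * M) = z / (e * M)"
    using nz by (simp add: z_def field_simps)
  define u where "u = e - A * p * K"
  have u: "1 - A * p * K / e = u / e"
    using nz by (simp add: u_def field_simps)
  define t where "t = p - e * K\<^sup>2"
  have t: "1 - e * K\<^sup>2 / p = t / p"
    using nz by (simp add: t_def field_simps)
  define c3 where "c3 = 1 - A * K^3"
  define c2 where "c2 = 1 - A * K\<^sup>2"
  define g where "g = 1 - e * M * K"
  define h where "h = 1 - e * M * p * K"
  define l where "l = 1 - e * p\<^sup>2 * M\<^sup>2"
  define k1 where "k1 = 1 - K"
  note atoms = D_def[symmetric] a_def[symmetric] b_def[symmetric] f_def[symmetric]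
    s_def[symmetric] c3_def[symmetric] c2_def[symmetric] g_def[symmetric] h_def[symmetric]
    l_def[symmetric] k1_def[symmetric]
  have T2: "?T2 = \<kappa> * (- w * p * c3 * g * h * z)"
    unfolding f z atoms \<kappa>_def using nz(1-3) nz' by (simp add: divide_simps)
  have T1: "?r * ?T1 = \<kappa> * (- (a * e * c3 * x * y * D))"
    unfolding w v x y atoms \<kappa>_def using nz(1-3) nz'
    by (simp add: divide_simps power2_eq_square)
  have G1: "?c * ?G1 = \<kappa> * (- l * (c2 * x * g * u * K))"
    unfolding w x u atoms \<kappa>_def using nz(1-3) nz'
    by (simp add: divide_simps power2_eq_square)
  have G0: "?c * ?G0 = \<kappa> * (- l * (D * z * k1 * t))"
    unfolding w z t atoms \<kappa>_def using nz(1-3) nz'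
    by (simp add: divide_simps power2_eq_square)
  have "- w * p * c3 * g * h * z + a * e * c3 * x * y * D = - l * (c2 * x * g * u * K - D * z * k1 * t)"
    using wz_poly[of M p A K e]
    by (simp add: w_def a_def c3_def g_def h_def z_def x_def y_def D_def l_def c2_def u_def k1_def t_def)
  then have "\<kappa> * (- w * p * c3 * g * h * z) - \<kappa> * (- (a * e * c3 * x * y * D)) =
     \<kappa> * (- l * (c2 * x * g * u * K)) - \<kappa> * (- l * (D * z * k1 * t))"
    by (metis (no_types, lifting) diff_minus_eq_add mult_minus_left right_diff_distrib)
  then show ?thesis
    unfolding right_diff_distrib[of ?c] T2 T1 G1 G0 .
qed

text \<open>For \<open>M = p ^ N\<close> these conditions keep every denominator of the terms, of
  the certificate and of the recurrence coefficient away from zero; \<open>Ae_pow\<close> takes care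
  of those containing \<open>A / (e * M)\<close>.\<close>

locale quadratic_params =
  fixes A e p :: "'a::field"
  assumes nonzero: "A \<noteq> 0" "e \<noteq> 0" "p \<noteq> 0"
    and p_pow: "\<And>i. p ^ Suc i \<noteq> 1"
    and e_pow: "\<And>i. e * p ^ i \<noteq> 1"
    and A_pow: "\<And>i. A * p ^ i \<noteq> 1"
    and Ae_pow: "\<And>i j. A * p ^ i \<noteq> e * p ^ j"
begin

text \<open>
  The Wilf--Zeilberger certificate for the recurrence \<open>M \<mapsto> M * p\<^sup>2\<close>, found by interpolation:
  its quotient by \<open>qbase\<close> turns out to be a polynomial in \<open>p ^ k\<close>.
\<close>

definition cert :: "'a \<Rightarrow> nat \<Rightarrow> 'a" where
  "cert M k = ((1 - A * p\<^sup>2 * M) * e * M * (1 - e * p\<^sup>2 * M\<^sup>2)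
        / ((1 - e * M) * (1 - e * M * p) * (A - e * M) * (1 - M * p\<^sup>2)))
     * ((1 - A * (p ^ k)\<^sup>2 / (e * M)) * (1 - p ^ k) * (1 - e * (p ^ k)\<^sup>2 / p)) * qbase A e p M k"

lemma qterm_telescope:
  assumes M: "M = p ^ N"
  shows "qterm A e p (M * p\<^sup>2) k
      - (1 - M * p) * (1 - A * p\<^sup>2 * M) * e / ((A - e * M) * (1 - e * M * p) * p) * qterm A e p M k
    = cert M (Suc k) - cert M k"
proof -
  define K where "K = p ^ k"
  have e1: "e * M \<noteq> 1" "e * M * p \<noteq> 1"
    using e_pow[of N] e_pow[of "Suc N"] by (simp_all add: M mult_ac)
  have M1: "M * p\<^sup>2 \<noteq> 1" "M * p \<noteq> 1" "M \<noteq> 0"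
    using p_pow[of "Suc N"] p_pow[of N] nonzero by (simp_all add: M power2_eq_square mult_ac)
  have A1: "A * p\<^sup>2 * M \<noteq> 1"  "A * p\<^sup>2 * M * K\<^sup>2 \<noteq> 1"
    using A_pow[of "2 + N"] A_pow[of "2 + N + 2 * k"]
    by (simp_all add: M K_def power_add power_mult power2_eq_square power_mult_distrib mult_ac)
  have A2: "A \<noteq> e * M" "A * p\<^sup>2 / (e * M) * p ^ i \<noteq> 1" for i
    using Ae_pow[of 0 N] Ae_pow[of "2 + i" N] M1 nonzero
    by (simp_all add: M power2_eq_square field_simps)
  have K1: "1 - p * K \<noteq> 0" "1 - e * p * K\<^sup>2 \<noteq> 0" "1 - A * p\<^sup>2 * K\<^sup>2 / (e * M) \<noteq> 0"
    using p_pow[of k] e_pow[of "1 + 2 * k"] A2(2)[of "2 * k"]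
    by (simp_all add: K_def power_mult power_add power_mult_distrib power2_eq_square mult_ac)
  \<comment> \<open>The factors of the certificate at \<open>k + 1\<close> cancel three of the four
    denominators in the ratio of consecutive values of \<open>qbase\<close>.\<close>
  have Suc: "cert M (Suc k) = ((1 - A * p\<^sup>2 * M) * e * M * (1 - e * p\<^sup>2 * M\<^sup>2)
        / ((1 - e * M) * (1 - e * M * p) * (A - e * M) * (1 - M * p\<^sup>2)))
     * ((1 - A * K\<^sup>2) * (1 - K / (M * p\<^sup>2)) * (1 - e * M * K) * (1 - A * p * K / e) * (p * K)
         / (1 - A * p\<^sup>2 * M * K\<^sup>2)) * qbase A e p M k"
  proof -
    have Kp: "p ^ Suc k = p * K"
      by (simp add: K_def)
    have "A * (p * K)\<^sup>2 / (e * M) = A * p\<^sup>2 * K\<^sup>2 / (e * M)" "e * (p * K)\<^sup>2 / p = e * p * K\<^sup>2"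
      using nonzero by (simp_all add: power2_eq_square)
    then show ?thesis
      unfolding cert_def qbase_Suc Kp unfolding K_def[symmetric] using K1 nonzero M1(3)
      by (simp add: power_mult_distrib mult.assoc)
  qed
  have factor: "b * t2 - r * (b * t1) = c * g1 * b - c * g0 * b"
    if "t2 - r * t1 = c * (g1 - g0)" for b c r t1 t2 g0 g1 :: 'a
  proof -
    have "b * t2 - r * (b * t1) = b * (t2 - r * t1)"
      by (simp add: algebra_simps)
    then show ?thesis
      unfolding that by (simp add: algebra_simps)
  qed
  show ?thesis
    unfolding Suc unfolding qterm_shift_eq_qbase[of p M e A k, OF nonzero(3) M1(3) nonzero(2) e1 A2(1) A1(1)
        A1(2)[unfolded K_def] A2(2)]
      qterm_eq_qbase[of p M A e k, OF nonzero(3) M1]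
      cert_def K_def[symmetric]
    by (rule factor[OF wz_step[of p M e A K, OF nonzero(3) M1(3) nonzero(2) e1 A2(1) M1(1,2) A1(2)]])
qed

section \<open>Recurrence and closed form of the sum\<close>

lemma qpoch_inverse_pow_eq_0:
  assumes "k > N"
  shows "qpoch (1 / p ^ N) p k = 0"
  using assms nonzero by (auto simp: qpoch_def intro!: bexI[of _ N])

lemma qterm_eq_0: "k > N \<Longrightarrow> qterm A e p (p ^ N) k = 0"
  by (simp add: qterm_def qpoch_inverse_pow_eq_0)

text \<open>The certificate vanishes at both ends of the telescoping sum: at \<open>k = 0\<close>
  through \<open>1 - p ^ k\<close>, and at \<open>k = N + 3\<close> through the symbol at
  \<open>1 / p ^ (N + 2)\<close> in \<open>qbase\<close>.\<close>

lemma sum_qterm_step: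
  "(\<Sum>k\<le>N + 2. qterm A e p (p ^ (N + 2)) k) =
     (1 - p ^ N * p) * (1 - A * p\<^sup>2 * p ^ N) * e / ((A - e * p ^ N) * (1 - e * p ^ N * p) * p)
     * (\<Sum>k\<le>N. qterm A e p (p ^ N) k)"
proof -
  define r where "r = (1 - p ^ N * p) * (1 - A * p\<^sup>2 * p ^ N) * e
     / ((A - e * p ^ N) * (1 - e * p ^ N * p) * p)"
  have "(\<Sum>k\<le>N. qterm A e p (p ^ N) k) = (\<Sum>k<N + 3. qterm A e p (p ^ N) k)"
    by (rule sum.mono_neutral_left) (auto simp: qterm_eq_0)
  moreover have "{..N + 2} = {..<N + 3}"
    by auto
  moreover have "p ^ (N + 2) = p ^ N * p\<^sup>2"
    by (rule power_add)
  ultimately have "(\<Sum>k\<le>N + 2. qterm A e p (p ^ (N + 2)) k) - r * (\<Sum>k\<le>N. qterm A e p (p ^ N) k)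
     = (\<Sum>k<N + 3. qterm A e p (p ^ N * p\<^sup>2) k - r * qterm A e p (p ^ N) k)"
    by (simp only: sum_subtractf sum_distrib_left)
  also have "\<dots> = (\<Sum>k<N + 3. cert (p ^ N) (Suc k) - cert (p ^ N) k)"
    by (rule sum.cong) (simp_all only: r_def qterm_telescope[OF refl])
  also have "\<dots> = cert (p ^ N) (N + 3) - cert (p ^ N) 0"
    by (rule sum_lessThan_telescope)
  also have "\<dots> = 0"
    using qpoch_inverse_pow_eq_0[of "N + 2" "N + 3", unfolded power_add[of p N 2]]
    by (simp add: cert_def qbase_def)
  finally show ?thesis
    by (simp add: r_def)
qed

text \<open>The recurrence is iterated from \<open>N = 0\<close>, where only the term
  \<open>1 - A\<close> is left; each step adds one factor to every symbol.\<close>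

theorem sum_qterm_even:
  "(\<Sum>k\<le>2 * m. qterm A e p (p ^ (2 * m)) k) =
     (1 - A) * (qpoch p (p\<^sup>2) m * qpoch (A * p\<^sup>2) (p\<^sup>2) m
       / (qpoch (e / A) (p\<^sup>2) m * qpoch (e * p) (p\<^sup>2) m)) * (e / (A * p)) ^ m"
proof (induction m)
  case 0
  show ?case by (simp add: qterm_def)
next
  case (Suc m)
  have r: "(1 - M * p) * (1 - A * p\<^sup>2 * M) * e / ((A - e * M) * (1 - e * M * p) * p) =
     (1 - p * M) * (1 - A * p\<^sup>2 * M) / ((1 - e / A * M) * (1 - e * p * M)) * (e / (A * p))" for M
  proof -
    have "A - e * M = A * (1 - e / A * M)"
      using nonzero by (simp add: field_simps)
    then show ?thesis by (simp add: mult_ac)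
  qed
  have eq: "2 * Suc m = 2 * m + 2" by simp
  show ?case
    unfolding eq sum_qterm_step Suc.IH r qpoch_Suc unfolding power_mult by (simp add: mult_ac)
qed

theorem sum_qterm_odd: "(\<Sum>k\<le>2 * m + 1. qterm A e p (p ^ (2 * m + 1)) k) = 0"
proof (induction m)
  case 0
  have "A * p ^ 3 \<noteq> 1" "e * p \<noteq> 1" "p \<noteq> 1" "A * p \<noteq> e"
    using A_pow[of 3] e_pow[of 1] p_pow[of 0] Ae_pow[of 1 0] by simp_all
  \<comment> \<open>For \<open>N = 1\<close> this term cancels the term \<open>1 - A\<close> at
    \<open>k = 0\<close>; the recurrence then carries the zero to every odd
    \<open>N\<close>.\<close>
  then have "qterm A e p p 1 = - (1 - A)"
    using nonzero by (simp add: qterm_def qpoch_def power3_eq_cube power2_eq_square divide_simps) (simp add: algebra_simps)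
  then show ?case by (simp add: qterm_def)
next
  case (Suc m)
  have eq: "2 * Suc m + 1 = 2 * m + 1 + 2" by simp
  show ?case
    unfolding eq sum_qterm_step Suc.IH by simp
qed

end

section \<open>Congruences modulo the square of a cyclotomic polynomial\<close>

text \<open>
  The subring of rational functions in which \<open>rf_cong\<close> is congruence modulo a principal ideal.
\<close>

definition localized :: "complex poly \<Rightarrow> ratfun set" where
  "localized P = {f. \<exists>a b. b \<noteq> 0 \<and> coprime b P \<and> f = Fract a b}"

lemma rf_cong_iff: "rf_cong f g P \<longleftrightarrow> (\<exists>r\<in>localized P. f - g = Fract P 1 * r)"
  unfolding rf_cong_def localized_def by blast

lemma localizedI: "b \<noteq> 0 \<Longrightarrow> coprime b P \<Longrightarrow> Fract a b \<in> localized P"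
  unfolding localized_def by blast

lemma localized_polynomial: "Fract a 1 \<in> localized P"
  by (simp add: localizedI)

lemma localized_inverse_polynomial: "a \<noteq> 0 \<Longrightarrow> coprime a P \<Longrightarrow> inverse (Fract a 1) \<in> localized P"
  by (simp add: localizedI)

lemma localized_0: "0 \<in> localized P" and localized_1: "1 \<in> localized P"
  using localized_polynomial[of 0 P] localized_polynomial[of 1 P]
  by (simp_all add: Zero_fract_def One_fract_def)

lemma localized_add: "f \<in> localized P \<Longrightarrow> g \<in> localized P \<Longrightarrow> f + g \<in> localized P"
proof -
  assume "f \<in> localized P" "g \<in> localized P"
  then obtain a b c d where "b \<noteq> 0" "coprime b P" "f = Fract a b" "d \<noteq> 0" "coprime d P" "g = Fract c d"
    unfolding localized_def by blast
  then show ?thesis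
    by (simp add: localizedI)
qed

lemma localized_mult: "f \<in> localized P \<Longrightarrow> g \<in> localized P \<Longrightarrow> f * g \<in> localized P"
proof -
  assume "f \<in> localized P" "g \<in> localized P"
  then obtain a b c d where "b \<noteq> 0" "coprime b P" "f = Fract a b" "d \<noteq> 0" "coprime d P" "g = Fract c d"
    unfolding localized_def by blast
  then show ?thesis
    by (simp add: localizedI)
qed

lemma localized_uminus: "f \<in> localized P \<Longrightarrow> - f \<in> localized P"
proof -
  have "Fract (- 1) 1 = (- 1 :: ratfun)"
    by (simp add: One_fract_def)
  then show "f \<in> localized P \<Longrightarrow> - f \<in> localized P"
    using localized_mult[OF localized_polynomial[of "-1" P], of f] by simp
qed

lemma localized_diff: "f \<in> localized P \<Longrightarrow> g \<in> localized P \<Longrightarrow> f - g \<in> localized P"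
  using localized_add[OF _ localized_uminus, of f P g] by simp

lemma localized_prod: "(\<And>i. i \<in> I \<Longrightarrow> f i \<in> localized P) \<Longrightarrow> prod f I \<in> localized P"
  by (induction I rule: infinite_finite_induct) (auto intro: localized_1 localized_mult)

lemma localized_sum: "(\<And>i. i \<in> I \<Longrightarrow> f i \<in> localized P) \<Longrightarrow> sum f I \<in> localized P"
  by (induction I rule: infinite_finite_induct) (auto intro: localized_0 localized_add)

lemma localized_power: "f \<in> localized P \<Longrightarrow> f ^ k \<in> localized P"
  by (induction k) (auto intro: localized_1 localized_mult)

section \<open>Arithmetic of congruences\<close>

lemma rf_cong_refl: "rf_cong f f P"
  unfolding rf_cong_iff by (rule bexI[of _ 0]) (simp_all add: localized_0)

text \<open>The difference is \<open>(f - f') * g + f' * (g - g')\<close>, so the cofactors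
  \<open>g\<close> and \<open>f'\<close> have to lie in the subring.\<close>

lemma rf_cong_mult:
  assumes "rf_cong f f' P" "rf_cong g g' P" "f' \<in> localized P" "g \<in> localized P"
  shows "rf_cong (f * g) (f' * g') P"
proof -
  obtain r s where rs: "r \<in> localized P" "f - f' = Fract P 1 * r" "s \<in> localized P" "g - g' = Fract P 1 * s"
    using assms unfolding rf_cong_iff by blast
  have "f * g - f' * g' = (f - f') * g + f' * (g - g')"
    by (simp add: algebra_simps)
  also have "\<dots> = Fract P 1 * (r * g + f' * s)"
    unfolding rs by (simp only: distrib_left mult_ac)
  finally show ?thesis
    unfolding rf_cong_iff using rs assms by (blast intro: localized_add localized_mult)
qed

lemma rf_cong_mult_left:
  assumes "rf_cong g g' P" "f \<in> localized P"
  shows "rf_cong (f * g) (f * g') P"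
proof -
  obtain s where s: "s \<in> localized P" "g - g' = Fract P 1 * s"
    using assms unfolding rf_cong_iff by blast
  have "f * g - f * g' = Fract P 1 * (f * s)"
    unfolding right_diff_distrib[symmetric] s by (simp only: mult_ac)
  then show ?thesis
    unfolding rf_cong_iff using s assms by (blast intro: localized_mult)
qed

lemma rf_cong_inverse:
  assumes "rf_cong f g P" "f \<noteq> 0" "g \<noteq> 0" "inverse f \<in> localized P" "inverse g \<in> localized P"
  shows "rf_cong (inverse f) (inverse g) P"
proof -
  obtain r where r: "r \<in> localized P" "f - g = Fract P 1 * r"
    using assms unfolding rf_cong_iff by blast
  have "inverse f - inverse g = (f - g) * (- (inverse f * inverse g))"
    using assms by (simp add: field_simps)
  also have "\<dots> = Fract P 1 * (r * (- (inverse f * inverse g)))"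
    unfolding r by (simp only: mult.assoc)
  finally show ?thesis
    unfolding rf_cong_iff using r assms by (blast intro: localized_mult localized_uminus)
qed

lemma rf_cong_sum:
  assumes "\<And>i. i \<in> I \<Longrightarrow> rf_cong (f i) (g i) P"
  shows "rf_cong (sum f I) (sum g I) P"
proof -
  obtain r where r: "\<And>i. i \<in> I \<Longrightarrow> r i \<in> localized P \<and> f i - g i = Fract P 1 * r i"
    using assms unfolding rf_cong_iff by metis
  then have "sum f I - sum g I = Fract P 1 * sum r I"
    by (simp add: sum_subtractf[symmetric] sum_distrib_left)
  moreover have "sum r I \<in> localized P"
    using r by (blast intro: localized_sum)
  ultimately show ?thesis
    unfolding rf_cong_iff by blast
qed

lemma rf_cong_prod:
  assumes "\<And>i. i \<in> I \<Longrightarrow> rf_cong (f i) (g i) P"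
    and "\<And>i. i \<in> I \<Longrightarrow> f i \<in> localized P" "\<And>i. i \<in> I \<Longrightarrow> g i \<in> localized P"
  shows "rf_cong (prod f I) (prod g I) P"
  using assms
proof (induction I rule: infinite_finite_induct)
  case (insert i I)
  then show ?case
    by (auto intro!: rf_cong_mult localized_prod)
qed (auto intro: rf_cong_refl)

section \<open>Coprimality to the cyclotomic polynomial\<close>

lemma coprime_linear_poly:
  fixes a :: "complex poly"
  assumes "poly a c \<noteq> 0"
  shows "coprime a [:- c, 1:]"
proof -
  have "prime_elem [:- c, 1:]"
    by (rule prime_elem_linear_field_poly) simp
  then show ?thesis
    using assms by (metis coprime_commute poly_eq_0_iff_dvd prime_elem_imp_coprime)
qed

text \<open>The power is 1 exactly when \<open>m * k / n\<close> is an integer; coprimality then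
  removes \<open>k\<close>.\<close>

lemma cis_root_power_eq_1_iff:
  assumes "n > 0" "coprime k n"
  shows "cis (2 * pi * real k / real n) ^ m = 1 \<longleftrightarrow> n dvd m"
proof -
  have "cis (2 * pi * real k / real n) ^ m = 1 \<longleftrightarrow> (\<exists>i::int. m * (2 * pi * real k / real n) = of_int i * (2 * pi))"
    unfolding Complex.DeMoivre cis_eq_1_iff ..
  also have "\<dots> \<longleftrightarrow> (\<exists>i::int. int (m * k) = i * int n)"
  proof (rule ex_cong1)
    fix i :: int
    have "m * (2 * pi * real k / real n) = of_int i * (2 * pi) \<longleftrightarrow> real m * real k = of_int i * real n"
      using assms by (auto simp: field_simps)
    also have "\<dots> \<longleftrightarrow> real_of_int (int (m * k)) = real_of_int (i * int n)"
      by simp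
    finally show "m * (2 * pi * real k / real n) = of_int i * (2 * pi) \<longleftrightarrow> int (m * k) = i * int n"
      by (simp only: of_int_eq_iff)
  qed
  also have "\<dots> \<longleftrightarrow> n dvd m * k"
    by (metis dvd_def int_dvd_int_iff mult.commute)
  also have "\<dots> \<longleftrightarrow> n dvd m"
    using assms by (simp add: coprime_commute coprime_dvd_mult_left_iff)
  finally show ?thesis .
qed

lemma coprime_cyclotomic_square:
  assumes "\<And>k. coprime k n \<Longrightarrow> poly a (cis (2 * pi * real k / real n)) \<noteq> 0"
  shows "coprime a ((cyclotomic n)\<^sup>2)"
  unfolding cyclotomic_def coprime_power_right_iff using assms
  by (auto intro!: prod_coprime_right coprime_linear_poly)

text \<open>The primitive roots are distinct zeros of the right-hand side, so their linear factors
  are pairwise coprime divisors of it.\<close>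

lemma cyclotomic_dvd:
  assumes "n > 0"
  shows "cyclotomic n dvd monom 1 n - 1"
proof -
  define S where "S = {k. k \<in> {1..n} \<and> coprime k n}"
  define z where "z k = cis (2 * pi * real k / real n)" for k
  have inj: "inj_on z S"
  proof (rule inj_onI)
    fix i j assume ij: "i \<in> S" "j \<in> S" "z i = z j"
    have *: "i = j" if "i \<le> j" "i \<in> S" "j \<in> S" "z i = z j" for i j
    proof -
      \<comment> \<open>Equality of two roots makes a power of \<open>z 1\<close> with exponent
        below \<open>n\<close> equal to 1, which forces the exponent to be zero.\<close>
      have "z j = z i * z 1 ^ (j - i)"
        using \<open>i \<le> j\<close> unfolding z_def Complex.DeMoivre cis_mult
        by (simp add: add_divide_distrib[symmetric] ring_distribs mult.commute)
      with \<open>z i = z j\<close> have "z 1 ^ (j - i) = 1"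
        by (simp add: z_def)
      then have "n dvd j - i"
        using cis_root_power_eq_1_iff[of n 1 "j - i"] assms by (simp add: z_def)
      moreover have "j - i < n"
        using that by (auto simp: S_def)
      ultimately show ?thesis
        using \<open>i \<le> j\<close> by (metis diff_is_0_eq dvd_imp_le le_antisym linorder_not_le neq0_conv)
    qed
    show "i = j"
      using *[of i j] *[of j i] ij by (cases "i \<le> j") auto
  qed
  have "(\<Prod>k\<in>T. [:- z k, 1:]) dvd monom 1 n - 1" if "T \<subseteq> S" for T
  proof -
    have "finite T" using that finite_subset[of T S] by (auto simp: S_def)
    then show ?thesis using that
    proof (induction T rule: finite_induct)
      case (insert k T)
      have "z k ^ n = 1"
        using insert.prems cis_root_power_eq_1_iff[of n k n] assms by (auto simp: z_def S_def)
      then have "[:- z k, 1:] dvd monom 1 n - 1"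
        by (simp add: poly_eq_0_iff_dvd[symmetric] poly_monom)
      moreover have "coprime [:- z k, 1:] (\<Prod>k\<in>T. [:- z k, 1:])"
        using insert inj by (intro prod_coprime_right coprime_linear_poly) (auto dest: inj_onD)
      ultimately show ?case
        unfolding prod.insert[OF insert.hyps] using insert by (intro divides_mult) auto
    qed simp
  qed
  from this[of S] show ?thesis
    by (simp add: cyclotomic_def S_def z_def)
qed

lemma qvar_power: "qvar ^ m = Fract (monom 1 m) 1"
  by (induction m) (simp_all add: qvar_def One_fract_def monom_Suc one_pCons)

text \<open>\<open>q\<close> is a unit of the subring because 0 is not a root of the cyclotomic
  polynomial.\<close>

lemma localized_qvar_powi:
  "qvar powi m \<in> localized ((cyclotomic n)\<^sup>2)"
proof (cases "m \<ge> 0")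
  case True
  then show ?thesis
    using localized_polynomial by (simp add: power_int_def qvar_power)
next
  case False
  have "coprime (monom 1 (nat (- m))) ((cyclotomic n)\<^sup>2)"
    by (rule coprime_cyclotomic_square) (simp add: poly_monom)
  then show ?thesis
    using False localized_inverse_polynomial[of "monom 1 (nat (- m))"]
    by (simp add: power_int_def qvar_power power_inverse del: inverse_fract)
qed

lemma qvar_powi_ne_1: "m \<noteq> 0 \<Longrightarrow> qvar powi m \<noteq> 1"
proof -
  have "qvar ^ k \<noteq> 1" if "k > 0" for k
    using that by (auto simp: qvar_power One_fract_def eq_fract monom_eq_1_iff)
  then show "m \<noteq> 0 \<Longrightarrow> qvar powi m \<noteq> 1"
    by (auto simp: power_int_def power_inverse)
qed

text \<open>At a primitive \<open>n\<close>-th root of unity \<open>1 - q^m\<close> vanishes only if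
  \<open>n\<close> divides \<open>m\<close>. This reduces the treatment of denominators to
  divisibility of exponents.\<close>

lemma localized_inverse_1_minus_qvar:
  assumes "n > 0" "\<not> int n dvd m"
  shows "inverse (1 - qvar powi m) \<in> localized ((cyclotomic n)\<^sup>2)"
proof -
  have nat: "inverse (1 - qvar ^ k) \<in> localized ((cyclotomic n)\<^sup>2)" if "\<not> n dvd k" for k
  proof -
    have "1 - qvar ^ k = Fract (1 - monom 1 k) 1"
      by (simp add: qvar_power One_fract_def)
    moreover have "coprime (1 - monom 1 k) ((cyclotomic n)\<^sup>2)"
      by (rule coprime_cyclotomic_square)
        (use cis_root_power_eq_1_iff[of n _ k] assms that in \<open>auto simp: poly_monom\<close>)
    moreover have "1 - monom 1 k \<noteq> (0 :: complex poly)"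
      using that by (auto simp: monom_eq_1_iff dest!: sym[of 1] intro: gr0I)
    ultimately show ?thesis
      using localized_inverse_polynomial by simp
  qed
  show ?thesis
  proof (cases "m \<ge> 0")
    case True
    then show ?thesis
      using nat[of "nat m"] assms by (auto simp: power_int_def nat_dvd_iff int_dvd_int_iff[symmetric])
  next
    case False
    define k where "k = nat (- m)"
    have m: "m = - int k" using False by (simp add: k_def)
    have "inverse (1 - qvar powi m) = - (qvar ^ k * inverse (1 - qvar ^ k))"
      using False qvar_nz qvar_powi_ne_1[of "int k"] 
      by (simp add: m power_int_minus field_simps)
    then show ?thesis
      using nat[of k] assms localized_qvar_powi[of "int k" n]
      by (auto simp: m intro!: localized_uminus localized_mult)
  qed
qed

text \<open>The difference is \<open>q^(a - n) * (1 - q^n)^2\<close>, and the cyclotomic polynomial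
  divides \<open>q^n - 1\<close>: hence the square in the modulus.\<close>

lemma rf_cong_shifted_square:
  assumes "n > 0"
  shows "rf_cong ((1 - qvar powi a)\<^sup>2)
     ((1 - qvar powi (a - int n)) * (1 - qvar powi (a + int n))) ((cyclotomic n)\<^sup>2)"
proof -
  obtain g where g: "monom 1 n - 1 = cyclotomic n * g"
    using cyclotomic_dvd[OF assms] by blast
  have "qvar ^ n - 1 = Fract (cyclotomic n * g) 1"
    using g by (simp add: qvar_power One_fract_def)
  then have sq: "(qvar ^ n - 1)\<^sup>2 = Fract ((cyclotomic n)\<^sup>2) 1 * Fract (g\<^sup>2) 1"
    by (simp add: power2_eq_square mult_ac)
  define x where "x = qvar powi a"
  have nz: "qvar ^ n \<noteq> 0" using qvar_nz by simp
  have "(1 - qvar powi a)\<^sup>2 - (1 - qvar powi (a - int n)) * (1 - qvar powi (a + int n))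
      = (1 - x)\<^sup>2 - (1 - x / qvar ^ n) * (1 - x * qvar ^ n)"
    using qvar_nz by (simp add: x_def power_int_diff power_int_add)
  also have "\<dots> = (qvar ^ n - 1)\<^sup>2 * (x / qvar ^ n)"
    using nz by (simp add: field_simps power2_eq_square)
  also have "x / qvar ^ n = qvar powi (a - int n)"
    using qvar_nz by (simp add: x_def power_int_diff)
  finally show ?thesis
    unfolding rf_cong_iff sq mult.assoc
    using localized_mult[OF localized_polynomial localized_qvar_powi] by blast
qed

section \<open>The congruence\<close>

lemma qvar_powi_eq_iff: "qvar powi a = qvar powi b \<longleftrightarrow> a = b"
proof
  assume "qvar powi a = qvar powi b"
  then have "qvar powi (a - b) = 1"
    using qvar_nz by (simp add: power_int_diff)
  then show "a = b"
    using qvar_powi_ne_1[of "a - b"] by auto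
qed simp

lemma qpoch_powi:
  "qpoch (qvar powi a) (qvar powi b) k = (\<Prod>j<k. 1 - qvar powi (a + b * int j))"
  using qvar_nz by (simp add: qpoch_def power_int_add power_int_mult)

lemma localized_1_minus_qvar: "1 - qvar powi a \<in> localized ((cyclotomic n)\<^sup>2)"
  by (intro localized_diff localized_1 localized_qvar_powi)

lemma localized_qpoch: "qpoch (qvar powi a) (qvar powi b) k \<in> localized ((cyclotomic n)\<^sup>2)"
  unfolding qpoch_powi by (intro localized_prod localized_1_minus_qvar)

lemma localized_inverse_qpoch:
  assumes "n > 0" "\<And>j. j < k \<Longrightarrow> \<not> int n dvd a + b * int j"
  shows "inverse (qpoch (qvar powi a) (qvar powi b) k) \<in> localized ((cyclotomic n)\<^sup>2)"
  unfolding qpoch_powi prod_inversef[symmetric] comp_def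
  using assms by (intro localized_prod localized_inverse_1_minus_qvar) auto

lemma qpoch_qvar_nonzero:
  assumes "\<And>j. j < k \<Longrightarrow> a + b * int j \<noteq> 0"
  shows "qpoch (qvar powi a) (qvar powi b) k \<noteq> 0"
  unfolding qpoch_powi using assms qvar_powi_ne_1 by auto

lemma rf_cong_qpoch_square:
  assumes "n > 0"
  shows "rf_cong ((qpoch (qvar powi a) (qvar powi b) k)\<^sup>2)
     (qpoch (qvar powi (a - int n)) (qvar powi b) k * qpoch (qvar powi (a + int n)) (qvar powi b) k)
     ((cyclotomic n)\<^sup>2)"
proof -
  have "rf_cong (\<Prod>j<k. (1 - qvar powi (a + b * int j))\<^sup>2)
     (\<Prod>j<k. (1 - qvar powi (a + b * int j - int n)) * (1 - qvar powi (a + b * int j + int n)))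
     ((cyclotomic n)\<^sup>2)"
    by (intro rf_cong_prod rf_cong_shifted_square assms localized_power localized_mult
        localized_1_minus_qvar)
  then show ?thesis
    unfolding qpoch_powi prod_power_distrib[symmetric] prod.distrib
    by (simp add: algebra_simps)
qed

text \<open>Each condition says that an integer exponent is nonzero. The critical one is
  \<open>Ae_pow\<close>: a violation would make \<open>d\<close> a divisor of 3.\<close>

lemma quadratic_params_qvar:
  assumes "d \<ge> 2" "d \<noteq> 3"
  shows "quadratic_params (qvar powi (-1)) (qvar powi 2) (qvar powi int d)"
proof
  have pow: "(qvar powi int d) ^ i = qvar powi (int d * int i)" for i
    by (simp add: power_int_mult)
  show "qvar powi (-1) \<noteq> 0" "qvar powi 2 \<noteq> 0" "qvar powi int d \<noteq> 0"
    using qvar_nz by simp_all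
  show "(qvar powi int d) ^ Suc i \<noteq> 1" for i
    unfolding pow using assms by (intro qvar_powi_ne_1) simp
  have "2 + int d * int i > 0" for i
    by (simp add: add_pos_nonneg)
  then show "qvar powi 2 * (qvar powi int d) ^ i \<noteq> 1" for i
    unfolding pow power_int_add[symmetric, OF disjI1[OF qvar_nz]]
    by (intro qvar_powi_ne_1 less_imp_neq[symmetric])
  have "int d * int i \<noteq> 1" for i
    using assms by (simp add: zmult_eq_1_iff)
  then show "qvar powi - 1 * (qvar powi int d) ^ i \<noteq> 1" for i
    unfolding pow power_int_add[symmetric, OF disjI1[OF qvar_nz]]
    by (intro qvar_powi_ne_1) (simp add: add_eq_0_iff)
  show "qvar powi - 1 * (qvar powi int d) ^ i \<noteq> qvar powi 2 * (qvar powi int d) ^ j" for i j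
  proof
    assume "qvar powi - 1 * (qvar powi int d) ^ i = qvar powi 2 * (qvar powi int d) ^ j"
    then have "-1 + int d * int i = 2 + int d * int j"
      unfolding pow power_int_add[symmetric, OF disjI1[OF qvar_nz]] qvar_powi_eq_iff .
    then have "int d * (int i - int j) = 3"
      by (simp add: algebra_simps)
    then have "int d dvd 3"
      by (metis dvd_triv_left)
    moreover from this have "d \<le> 3"
      using zdvd_imp_le by fastforce
    ultimately show False
      using assms by (cases "d = 2") auto
  qed
qed

section \<open>Coprime denominators and passage to the deformed sum\<close>

context
  fixes n d N :: nat
  assumes n_eq: "n = 1 + d * N" and d: "d \<ge> 2" and N: "N > 0"
begin

lemma coprime_nd: "coprime (int n) (int d)"
proof -
  have "is_unit c" if "c dvd int n" "c dvd int d" for c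
  proof -
    have "c dvd int n - int d * int N"
      using that by (intro dvd_diff dvd_mult2)
    then show ?thesis by (simp add: n_eq)
  qed
  then show ?thesis by (rule coprimeI)
qed

lemma int_n_dvd_mult_d: "int n dvd int d * x \<longleftrightarrow> int n dvd x"
  using coprime_nd by (simp add: coprime_dvd_mult_right_iff)

lemma n_gt: "int n > 2 * int N"
proof -
  have "2 * int N \<le> int d * int N" using d by (intro mult_right_mono) auto
  then show ?thesis by (simp add: n_eq)
qed

lemma not_dvd_d_mult:
  assumes "j < N"
  shows "\<not> int n dvd int d + int d * int j"
proof -
  have "int d + int d * int j = int d * (int j + 1)"
    by (simp add: algebra_simps)
  moreover have "\<not> int n dvd int j + 1"
    using n_gt assms zdvd_imp_le[of "int n" "int j + 1"] by auto
  ultimately show ?thesis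
    using int_n_dvd_mult_d by metis
qed

lemma not_dvd_d_plus_2:
  assumes "j < N"
  shows "\<not> int n dvd int d + 2 + 2 * int d * int j"
proof
  assume "int n dvd int d + 2 + 2 * int d * int j"
  \<comment> \<open>Since \<open>n = 1 + d * N\<close>, the summand 2 can be traded for a multiple
    of \<open>d\<close> modulo \<open>n\<close>; coprimality removes \<open>d\<close> and leaves an
    odd number strictly between 0 and \<open>n\<close>.\<close>
  moreover have "int d + 2 + 2 * int d * int j = 2 * int n - int d * (2 * int N - 2 * int j - 1)"
    by (simp add: n_eq algebra_simps)
  ultimately have "int n dvd int d * (2 * int N - 2 * int j - 1)"
    by (metis dvd_diff_right_iff dvd_triv_right)
  then have "int n dvd 2 * int N - 2 * int j - 1"
    unfolding int_n_dvd_mult_d .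
  then show False
    using n_gt assms zdvd_imp_le[of "int n" "2 * int N - 2 * int j - 1"] by auto
qed

text \<open>The same trade leaves \<open>2 * (j + 1 + N)\<close>, which is at most
  \<open>4 * N\<close> and so below \<open>n\<close> if \<open>d \<ge> 4\<close>. For
  \<open>d = 2\<close>, \<open>n\<close> is odd and half of that number is below \<open>n\<close>.
  For \<open>d = 3\<close> the bound is lost.\<close>

lemma not_dvd_2d_minus_2:
  assumes "j < N" "d \<noteq> 3"
  shows "\<not> int n dvd 2 * int d - 2 + 2 * int d * int j"
proof
  assume "int n dvd 2 * int d - 2 + 2 * int d * int j"
  moreover have "2 * int d - 2 + 2 * int d * int j = int d * (2 * (int j + 1 + int N)) - 2 * int n"
    by (simp add: n_eq algebra_simps)
  ultimately have "int n dvd int d * (2 * (int j + 1 + int N))"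
    by (metis dvd_diff_left_iff dvd_triv_right)
  then have dvd: "int n dvd 2 * (int j + 1 + int N)"
    unfolding int_n_dvd_mult_d .
  show False
  proof (cases "d = 2")
    case True
    then have "odd (int n)" by (simp add: n_eq)
    then have "coprime (int n) 2" by simp
    with dvd have "int n dvd int j + 1 + int N"
      by (simp only: coprime_dvd_mult_right_iff)
    then show False
      using n_gt assms zdvd_imp_le[of "int n" "int j + 1 + int N"] by auto
  next
    case False
    with d assms have "d \<ge> 4" by simp
    then have "4 * int N \<le> int d * int N" by (intro mult_right_mono) auto
    then have "int n > 4 * int N" by (simp add: n_eq)
    then show False
      using dvd assms zdvd_imp_le[of "int n" "2 * (int j + 1 + int N)"] by auto
  qed
qed

lemma qsum_cong_qterm:
  assumes "d \<noteq> 3"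
  shows "rf_cong (qsum n d)
     (- inverse (1 - qvar powi (-1)) *
        (\<Sum>k\<le>N. qterm (qvar powi (-1)) (qvar powi 2) (qvar powi int d) ((qvar powi int d) ^ N) k))
     ((cyclotomic n)\<^sup>2)"
proof -
  let ?L = "localized ((cyclotomic n)\<^sup>2)"
  let ?p = "qvar powi int d" and ?p2 = "qvar powi (2 * int d)"
  have n: "n > 0" by (simp add: n_eq)
  \<comment> \<open>\<open>C\<close> collects the factors that stay; the squares \<open>X\<close>
    and \<open>Y\<close> are replaced by \<open>X'\<close> and \<open>Y'\<close>, with exponents
    shifted by \<open>-n\<close> and \<open>n\<close>.\<close>
  define C where "C k = qint qvar (3 * int d * int k - 1)
       * (qpoch (qvar powi (-1)) ?p2 k * qpoch (qvar powi (int d - 3)) ?p k)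
       * (inverse (qpoch ?p ?p k) * inverse (qpoch (qvar powi (int d + 2)) ?p2 k))
       * qvar powi int (d * (k\<^sup>2 + k) div 2 + 1)" for k
  define X where "X k = (qpoch (qvar powi 1) ?p k)\<^sup>2" for k
  define Y where "Y k = (qpoch (qvar powi (2 * int d - 2)) ?p2 k)\<^sup>2" for k
  define X' where "X' k = qpoch (qvar powi (1 - int n)) ?p k * qpoch (qvar powi (1 + int n)) ?p k" for k
  define Y' where "Y' k = qpoch (qvar powi (2 * int d - 2 - int n)) ?p2 k
    * qpoch (qvar powi (2 * int d - 2 + int n)) ?p2 k" for k
  have "(n - 1) div d = N"
    using d by (simp add: n_eq)
  moreover have "qvar ^ (2 * d) = ?p2" "qvar ^ d = ?p" "qvar ^ (d + 2) = qvar powi (int d + 2)"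
    by (simp_all add: add.commute flip: power_int_of_nat)
  moreover have "a * (b * c * x\<^sup>2) / (u * v * y\<^sup>2) * w = a * (b * c) * (inverse u * inverse v) * w * (x\<^sup>2 * inverse (y\<^sup>2))"
    for a b c x u v y w :: ratfun
    by (simp add: divide_inverse mult_ac)
  ultimately have "qsum n d = (\<Sum>k\<le>N. C k * (X k * inverse (Y k)))"
    unfolding qsum_def Let_def atLeast0AtMost C_def X_def Y_def
    by (simp only: power_int_of_nat power_int_1_right)
  also have "rf_cong \<dots> (\<Sum>k\<le>N. C k * (X' k * inverse (Y' k))) ((cyclotomic n)\<^sup>2)"
  proof (rule rf_cong_sum)
    fix k assume "k \<in> {..N}"
    then have jk: "j < N" if "j < k" for j using that by simp
    \<comment> \<open>Shifting an exponent by \<open>n\<close> does not affect divisibility by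
      \<open>n\<close>, so the deformed denominators are invertible too.\<close>
    have dvd3: "\<not> int n dvd 2 * int d - 2 + 2 * int d * int j"
       "\<not> int n dvd 2 * int d - 2 - int n + 2 * int d * int j"
       "\<not> int n dvd 2 * int d - 2 + int n + 2 * int d * int j" if "j < k" for j
    proof -
      show *: "\<not> int n dvd 2 * int d - 2 + 2 * int d * int j"
        by (rule not_dvd_2d_minus_2[OF jk[OF that] assms])
      show "\<not> int n dvd 2 * int d - 2 - int n + 2 * int d * int j"
        using * dvd_add[of "int n" "2 * int d - 2 - int n + 2 * int d * int j" "int n"] by (auto simp: algebra_simps)
      show "\<not> int n dvd 2 * int d - 2 + int n + 2 * int d * int j"
        using * dvd_diff[of "int n" "2 * int d - 2 + int n + 2 * int d * int j" "int n"] by (auto simp: algebra_simps)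
    qed
    have C: "C k \<in> ?L"
    proof -
      have "\<not> int n dvd 1"
        using n_gt N by auto
      then have "qint qvar (3 * int d * int k - 1) \<in> ?L"
        using localized_inverse_1_minus_qvar[of n 1] n unfolding qint_def divide_inverse
        by (auto intro!: localized_mult localized_1_minus_qvar)
      then show ?thesis
        unfolding C_def using not_dvd_d_mult[OF jk] not_dvd_d_plus_2[OF jk]
        by (intro localized_mult localized_qpoch localized_inverse_qpoch localized_qvar_powi n)
    qed
    have Y: "inverse (Y k) \<in> ?L" "inverse (Y' k) \<in> ?L"
      unfolding Y_def Y'_def power_inverse[symmetric] inverse_mult_distrib using dvd3
      by (intro localized_power localized_mult localized_inverse_qpoch n; blast)+
    have nz: "Y k \<noteq> 0" "Y' k \<noteq> 0"
      unfolding Y_def Y'_def power_eq_0_iff mult_eq_0_iff using dvd3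
      by (metis qpoch_qvar_nonzero dvd_0_right)+
    have "rf_cong (inverse (Y k)) (inverse (Y' k)) ((cyclotomic n)\<^sup>2)"
      using rf_cong_qpoch_square[OF n] nz Y unfolding Y_def Y'_def by (intro rf_cong_inverse)
    moreover have "rf_cong (X k) (X' k) ((cyclotomic n)\<^sup>2)"
      unfolding X_def X'_def by (rule rf_cong_qpoch_square[OF n])
    moreover have "X' k \<in> ?L"
      unfolding X'_def by (intro localized_mult localized_qpoch)
    ultimately show "rf_cong (C k * (X k * inverse (Y k))) (C k * (X' k * inverse (Y' k))) ((cyclotomic n)\<^sup>2)"
      using C Y by (intro rf_cong_mult_left rf_cong_mult)
  qed
  also have "(\<Sum>k\<le>N. C k * (X' k * inverse (Y' k))) = - inverse (1 - qvar powi (-1)) *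
        (\<Sum>k\<le>N. qterm (qvar powi (-1)) (qvar powi 2) ?p (?p ^ N) k)"
    unfolding sum_distrib_left
  proof (rule sum.cong[OF refl])
    fix k
    \<comment> \<open>Since \<open>d * N = n - 1\<close>, the parameters are
      \<open>b = q^(1 - n)\<close> and \<open>c = q^(1 + n)\<close>.\<close>
    have args: "?p ^ N = qvar powi (int n - 1)" "?p\<^sup>2 = ?p2" "1 / qvar powi (int n - 1) = qvar powi (1 - int n)"
      "qvar powi 2 * qvar powi (int n - 1) = qvar powi (1 + int n)"
      "qvar powi -1 * ?p / qvar powi 2 = qvar powi (int d - 3)"
      "qvar powi -1 * ?p2 * qvar powi (int n - 1) = qvar powi (2 * int d - 2 + int n)"
      "qvar powi -1 * ?p2 / qvar powi (1 + int n) = qvar powi (2 * int d - 2 - int n)"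
      "qvar powi 2 * ?p = qvar powi (int d + 2)"
      "qvar powi -1 * ?p ^ (3 * k) = qvar powi (3 * int d * int k - 1)"
    proof -
      note add = power_int_add[OF disjI1[OF qvar_nz], symmetric]
      note diff = power_int_diff[OF disjI1[OF qvar_nz], symmetric]
      have pow: "?p ^ i = qvar powi (int d * int i)" for i
        by (simp add: power_int_mult)
      have "int d * int N = int n - 1"
        by (simp add: n_eq)
      then show "?p ^ N = qvar powi (int n - 1)"
        unfolding pow by simp
      show "?p\<^sup>2 = ?p2"
        unfolding pow by (simp add: mult.commute)
      have "1 = qvar powi 0" by simp
      then show "1 / qvar powi (int n - 1) = qvar powi (1 - int n)"
        using diff[of 0 "int n - 1"] by simp
      show "qvar powi 2 * qvar powi (int n - 1) = qvar powi (1 + int n)"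
        "qvar powi 2 * ?p = qvar powi (int d + 2)"
        "qvar powi -1 * ?p2 * qvar powi (int n - 1) = qvar powi (2 * int d - 2 + int n)"
        unfolding add by (simp_all add: algebra_simps)
      show "qvar powi -1 * ?p / qvar powi 2 = qvar powi (int d - 3)"
        "qvar powi -1 * ?p2 / qvar powi (1 + int n) = qvar powi (2 * int d - 2 - int n)"
        unfolding add diff by (simp_all add: algebra_simps)
      show "qvar powi -1 * ?p ^ (3 * k) = qvar powi (3 * int d * int k - 1)"
        unfolding pow add by (simp add: algebra_simps)
    qed
    have half: "d * (k\<^sup>2 + k) div 2 = d * (k * (k + 1) div 2)"
      by (simp add: power2_eq_square div_mult_swap add.commute)
    have pw: "?p ^ (k * (k + 1) div 2) = qvar powi int (d * (k * (k + 1) div 2))"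
      by (simp only: power_int_of_nat power_mult)
    \<comment> \<open>The extra factor \<open>q\<close> of the summand turns
      \<open>1 / (1 - q)\<close> into \<open>- 1 / (1 - q^(-1))\<close>, the normalisation by
      \<open>1 - A\<close>.\<close>
    have lead: "qint qvar (3 * int d * int k - 1) * qvar
       = - inverse (1 - qvar powi (-1)) * (1 - qvar powi (3 * int d * int k - 1))"
      using qvar_nz qvar_ne_1 by (simp add: qint_def power_int_minus field_simps)
    have "C k * (X' k * inverse (Y' k)) = qint qvar (3 * int d * int k - 1) * qvar
       * (qpoch (qvar powi (-1)) ?p2 k * qpoch (qvar powi (int d - 3)) ?p k)
       * (inverse (qpoch ?p ?p k) * inverse (qpoch (qvar powi (int d + 2)) ?p2 k))
       * qvar powi int (d * (k * (k + 1) div 2)) * (X' k * inverse (Y' k))"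
      unfolding C_def half by (simp add: power_int_add qvar_nz mult_ac)
    also have "\<dots> = - inverse (1 - qvar powi (-1)) * qterm (qvar powi (-1)) (qvar powi 2) ?p (?p ^ N) k"
      unfolding lead qterm_def args pw X'_def Y'_def by (simp add: divide_inverse mult_ac)
    finally show "C k * (X' k * inverse (Y' k)) =
      - inverse (1 - qvar powi (-1)) * qterm (qvar powi (-1)) (qvar powi 2) ?p (?p ^ N) k" .
  qed
  finally show ?thesis .
qed

end

section \<open>Degenerate cases and conclusion\<close>

lemma qsum_1: "qsum 1 d = -1"
proof -
  have "qint qvar (-1) * qvar = -1"
    using qvar_nz qvar_ne_1 by (simp add: qint_def field_simps power_int_minus)
  then show ?thesis by (simp add: qsum_def Let_def)
qed

text \<open>For \<open>d = 3\<close> numerator and denominator have the same symbols, and the power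
  of \<open>q\<close> has exponent 0.\<close>

lemma qrhs_3: "qrhs n 3 = -1"
proof -
  have "qpoch (qvar ^ 3) (qvar ^ 6) m \<noteq> 0" "qpoch (qvar ^ 5) (qvar ^ 6) m \<noteq> 0" for m
    using qpoch_qvar_nonzero[of m 3 6] qpoch_qvar_nonzero[of m 5 6] by simp_all
  then show ?thesis by (simp add: qrhs_def Let_def)
qed

text \<open>This is the closed form for \<open>N = 2 * m\<close> divided by
  \<open>- (1 - A)\<close>, since \<open>e / A\<close> is \<open>q^3\<close> and
  \<open>e / (A * p)\<close> is \<open>q^(3 - d)\<close>.\<close>

lemma qrhs_eq:
  assumes d: "d > 0" and n: "n = 1 + 2 * d * m"
  defines "A \<equiv> qvar powi (-1)" and "e \<equiv> qvar powi 2" and "p \<equiv> qvar powi int d"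
  shows "qrhs n d = - (qpoch p (p\<^sup>2) m * qpoch (A * p\<^sup>2) (p\<^sup>2) m
       / (qpoch (e / A) (p\<^sup>2) m * qpoch (e * p) (p\<^sup>2) m)) * (e / (A * p)) ^ m"
proof -
  note add = power_int_add[OF disjI1[OF qvar_nz], symmetric]
  note diff = power_int_diff[OF disjI1[OF qvar_nz], symmetric]
  have m: "(n - 1) div (2 * d) = m"
    using d by (simp add: n)
  have p2: "p\<^sup>2 = qvar powi (2 * int d)"
    by (simp add: p_def power_int_mult mult.commute[of 2])
  have "A * p\<^sup>2 = qvar powi (2 * int d - 1)" "e / A = qvar powi 3" "e * p = qvar powi (int d + 2)"
    "e / (A * p) = qvar powi (3 - int d)"
    unfolding p2 unfolding A_def e_def p_def add diff by (simp_all add: algebra_simps)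
  moreover have "qvar ^ (2 * d) = p\<^sup>2" "qvar ^ d = p" "qvar ^ (d + 2) = qvar powi (int d + 2)"
    unfolding p2 unfolding p_def by (simp_all add: add.commute flip: power_int_of_nat)
  moreover have "qvar ^ 3 = qvar powi 3" "qvar powi ((3 - int d) * int m) = (qvar powi (3 - int d)) ^ m"
    by (simp_all add: power_int_mult)
  ultimately show ?thesis
    unfolding qrhs_def Let_def m by (simp only:)
qed

theorem theorem7:
  fixes n d :: nat
  assumes "n > 0" and "d > 0" and "d \<noteq> 1"
  shows "([n = 1] (mod (2 * d)) \<longrightarrow> rf_cong (qsum n d) (qrhs n d) ((cyclotomic n)\<^sup>2)) \<and>
         ([n = d + 1] (mod (2 * d)) \<and> d \<noteq> 3 \<longrightarrow> rf_cong (qsum n d) 0 ((cyclotomic n)\<^sup>2))"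
proof (intro conjI impI; (elim conjE)?)
  have d: "d \<ge> 2" using assms by simp
  have A: "1 - qvar powi (-1) \<noteq> 0"
    using qvar_powi_ne_1[of "-1"] by simp
  {
    assume "[n = 1] (mod (2 * d))"
    then have "n mod (2 * d) = 1"
      using d by (simp add: cong_def)
    then obtain m where m: "n = 1 + 2 * d * m"
      by (metis mult_div_mod_eq add.commute)
    \<comment> \<open>For \<open>d = 3\<close> the parameters degenerate to
      \<open>A * p = e\<close>, and for \<open>n = 1\<close> the denominator \<open>1 - q\<close> is
      not coprime to the modulus; in both cases both sides are -1.\<close>
    consider "d = 3" | "m = 0" | "d \<noteq> 3" "m > 0" by auto
    then show "rf_cong (qsum n d) (qrhs n d) ((cyclotomic n)\<^sup>2)"
    proof cases
      case 1
      then show ?thesis by (simp add: qsum_3 qrhs_3 rf_cong_refl)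
    next
      case 2
      then have "qrhs n d = -1" "n = 1"
        by (simp_all add: m qrhs_def Let_def)
      then show ?thesis by (simp add: qsum_1 rf_cong_refl del: One_nat_def)
    next
      case 3
      interpret quadratic_params "qvar powi (-1)" "qvar powi 2" "qvar powi int d"
        by (rule quadratic_params_qvar) fact+
      have "n = 1 + d * (2 * m)" "2 * m > 0"
        using m 3 by simp_all
      \<comment> \<open>The factor \<open>1 - A\<close> of the closed form cancels the inverse in
        front of the sum.\<close>
      from qsum_cong_qterm[OF this(1) d this(2) 3(1)] show ?thesis
        unfolding sum_qterm_even qrhs_eq[OF assms(2) m] using A by (simp add: mult.assoc[symmetric])
    qed
  next
    assume "[n = d + 1] (mod (2 * d))" and d3: "d \<noteq> 3"
    then have "n mod (2 * d) = d + 1"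
      using d by (simp add: cong_def)
    then have "n = d + 1 + 2 * d * (n div (2 * d))"
      by (metis mult_div_mod_eq add.commute)
    then obtain m where "n = d + 1 + 2 * d * m" ..
    \<comment> \<open>The upper limit is the odd number \<open>N = 2 * m + 1\<close>, so the
      deformed sum vanishes identically.\<close>
    then have m: "n = 1 + d * (2 * m + 1)" by simp
    interpret quadratic_params "qvar powi (-1)" "qvar powi 2" "qvar powi int d"
      by (rule quadratic_params_qvar) fact+
    from qsum_cong_qterm[OF m d _ d3] show "rf_cong (qsum n d) 0 ((cyclotomic n)\<^sup>2)"
      unfolding sum_qterm_odd by simp
  }
qed

end
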